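(* Consider the following task. There is an unknown $n$-qubit state $\rho$, and we are given $M$ observables $O_1,\dots,O_M$ with $\max_i\|O_i\|\le B_\infty$. Each observable $O_i$ is a sum of few-body observables, where every qubit is acted on by $\mathcal{O}(1)$ of the few-body observables. We would like to estimate $\mathrm{tr}(O_i\rho)$ to $\epsilon$ error for all $i\in\{1,\dots,M\}$ with high probability by performing arbitrary collective measurements on $N$ copies of $\rho$. The number of copies $N$ must be at least $$N=\Omega\left(\frac{\log\big(\min(M,n)\big)\,B_\infty^2}{\epsilon^2}\right)$$ for any algorithm to succeed in this task.
   Context: $\|\cdot\|$ is the spectral norm. A few-body observable acts nontrivially on at most a constant number of qubits. The observables are $n$-qubit observables, and succeeding in the task means succeeding for any unknown $n$-qubit state $\rho$ and any $M$ observables of the described form. A collective measurement is an arbitrary quantum measurement performed jointly on the $N$ copies $\rho^{\otimes N}$.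
   Formalization: The bound is stated for ε ≤ r·B_∞ with any fixed r < 1 (the Ω constant may depend on r), since for ε ≥ B_∞ always answering 0 succeeds with no copies; "high probability" means any fixed success probability p > 1/2. *)

theory Defs
  imports
    "HOL-Analysis.Finite_Product_Measure"
    "Jordan_Normal_Form.Schur_Decomposition"
begin

no_notation Finite_Cartesian_Product.vec_nth (infixl \<open>$\<close> 90)
hide_type (open) Finite_Cartesian_Product.vec
hide_const (open) Finite_Cartesian_Product.vec

definition mat_trace :: "complex mat \<Rightarrow> complex" where
  "mat_trace A = (\<Sum>i<dim_row A. A $$ (i, i))"

definition vec_l2norm :: "complex vec \<Rightarrow> real" where
  "vec_l2norm v = sqrt (Re (v \<bullet>c v))"

definition spectral_norm :: "complex mat \<Rightarrow> real" where
  "spectral_norm A =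
     Sup {vec_l2norm (A *\<^sub>v v) | v. v \<in> carrier_vec (dim_col A) \<and> vec_l2norm v = 1}"

(* The order on complex numbers: 0 \<le> z means that z is real and nonnegative.
   Over the complex numbers this already forces A to be Hermitian. *)
definition pos_semidef :: "nat \<Rightarrow> complex mat \<Rightarrow> bool" where
  "pos_semidef D A \<longleftrightarrow>
     A \<in> carrier_mat D D \<and> (\<forall>v\<in>carrier_vec D. 0 \<le> (A *\<^sub>v v) \<bullet>c v)"

definition kron :: "complex mat \<Rightarrow> complex mat \<Rightarrow> complex mat" where
  "kron A B = mat (dim_row A * dim_row B) (dim_col A * dim_col B)
     (\<lambda>(i, j). A $$ (i div dim_row B, j div dim_col B) * B $$ (i mod dim_row B, j mod dim_col B))"

primrec kron_pow :: "complex mat \<Rightarrow> nat \<Rightarrow> complex mat" where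
  "kron_pow A 0 = 1\<^sub>m 1"
| "kron_pow A (Suc N) = kron A (kron_pow A N)"

text \<open>
  An operator on n qubits is a matrix of dimension 2 ^ n; the computational basis state with index
  i has qubit q in state 1 iff binary digit q of i is 1.
\<close>

definition observable :: "nat \<Rightarrow> complex mat \<Rightarrow> bool" where
  "observable n A \<longleftrightarrow> A \<in> carrier_mat (2 ^ n) (2 ^ n) \<and> mat_adjoint A = A"

definition density :: "nat \<Rightarrow> complex mat \<Rightarrow> bool" where
  "density n \<rho> \<longleftrightarrow> pos_semidef (2 ^ n) \<rho> \<and> mat_trace \<rho> = 1"

(* A is the identity on qubit q tensored with an operator A' on the remaining qubits;
   A' is indexed by the basis indices whose digit q is 0. *)
definition acts_trivially_on :: "nat \<Rightarrow> nat \<Rightarrow> complex mat \<Rightarrow> bool" where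
  "acts_trivially_on n q A \<longleftrightarrow>
     (\<exists>A' :: nat \<Rightarrow> nat \<Rightarrow> complex. \<forall>i<2 ^ n. \<forall>j<2 ^ n.
        A $$ (i, j) = (if bit i q = bit j q then A' (unset_bit q i) (unset_bit q j) else 0))"

definition qubit_support :: "nat \<Rightarrow> complex mat \<Rightarrow> nat set" where
  "qubit_support n A = {q. q < n \<and> \<not> acts_trivially_on n q A}"

definition few_body :: "nat \<Rightarrow> nat \<Rightarrow> complex mat \<Rightarrow> bool" where
  "few_body n k A \<longleftrightarrow> observable n A \<and> card (qubit_support n A) \<le> k"

definition few_body_sum :: "nat \<Rightarrow> nat \<Rightarrow> nat \<Rightarrow> complex mat \<Rightarrow> bool" where
  "few_body_sum n k d A \<longleftrightarrow>
     (\<exists>Ps :: complex mat list.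
        (\<forall>P\<in>set Ps. few_body n k P) \<and>
        (\<forall>q<n. card {a. a < length Ps \<and> q \<in> qubit_support n (Ps ! a)} \<le> d) \<and>
        A = foldr (+) Ps (0\<^sub>m (2 ^ n) (2 ^ n)))"

definition admissible_observables ::
    "nat \<Rightarrow> nat \<Rightarrow> nat \<Rightarrow> nat \<Rightarrow> real \<Rightarrow> complex mat list \<Rightarrow> bool" where
  "admissible_observables n M k d B Os \<longleftrightarrow>
     length Os = M \<and> (\<forall>A\<in>set Os. few_body_sum n k d A \<and> spectral_norm A \<le> B)"

(* General, possibly continuous, measurements in dimension D. The argument \<Omega> only serves as the
   measurable space of outcomes, its measure is irrelevant. *)
definition povm :: "nat \<Rightarrow> 'a measure \<Rightarrow> ('a set \<Rightarrow> complex mat) \<Rightarrow> bool" where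
  "povm D \<Omega> E \<longleftrightarrow>
     (\<forall>S\<in>sets \<Omega>. pos_semidef D (E S)) \<and>
     E (space \<Omega>) = 1\<^sub>m D \<and>
     (\<forall>F :: nat \<Rightarrow> 'a set. range F \<subseteq> sets \<Omega> \<longrightarrow> disjoint_family F \<longrightarrow>
        (\<forall>i<D. \<forall>j<D. (\<lambda>m. E (F m) $$ (i, j)) sums (E (\<Union>m. F m) $$ (i, j))))"

definition outcome_prob :: "('a set \<Rightarrow> complex mat) \<Rightarrow> complex mat \<Rightarrow> 'a set \<Rightarrow> real" where
  "outcome_prob E \<sigma> S = Re (mat_trace (E S * \<sigma>))"

abbreviation estimate_space :: "nat \<Rightarrow> (nat \<Rightarrow> real) measure" where
  "estimate_space M \<equiv> PiM {..<M} (\<lambda>_. borel)"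

definition accurate_estimates ::
    "complex mat list \<Rightarrow> complex mat \<Rightarrow> real \<Rightarrow> (nat \<Rightarrow> real) set" where
  "accurate_estimates Os \<rho> \<epsilon> =
     {y \<in> space (estimate_space (length Os)).
        \<forall>i<length Os. \<bar>y i - Re (mat_trace (Os ! i * \<rho>))\<bar> \<le> \<epsilon>}"

(* An algorithm maps the given observables to a collective measurement of the N copies. Classical
   post-processing, deterministic or randomized, is part of the measurement, whose outcome is the
   tuple of the M estimates. *)
definition solves_task ::
    "nat \<Rightarrow> nat \<Rightarrow> nat \<Rightarrow> nat \<Rightarrow> real \<Rightarrow> real \<Rightarrow> real \<Rightarrow> nat \<Rightarrow>
     (complex mat list \<Rightarrow> (nat \<Rightarrow> real) set \<Rightarrow> complex mat) \<Rightarrow> bool" where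
  "solves_task n M k d B \<epsilon> p N alg \<longleftrightarrow>
     (\<forall>Os. admissible_observables n M k d B Os \<longrightarrow>
        povm ((2 ^ n) ^ N) (estimate_space M) (alg Os) \<and>
        (\<forall>\<rho>. density n \<rho> \<longrightarrow>
           outcome_prob (alg Os) (kron_pow \<rho> N) (accurate_estimates Os \<rho> \<epsilon>) \<ge> p))"

end

theory Submission
  imports Defs
begin

(* The hard instance is classical: the observables are B times the Pauli Z operators of single
   qubits and the states are products of biased bits, so that a measurement only sees the diagonal
   of its effects. In the reference state every bit has bias -delta; in the j-th alternative the
   bias of bit j is flipped to +delta. As delta > epsilon / B, the sets of accurate answers for the
   reference state and for the m = min M n alternatives are pairwise disjoint. Hence the reference
   state gives the m alternative sets total probability at most 1 - p, while each alternative gives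
   its own set probability at least p. By the Cauchy-Schwarz inequality (chi-squared change of
   measure) m p^2 \<le> (1 - p) (1 + chi^2)^N, where chi^2 = 4 delta^2 / (1 - delta^2) for one copy.
   Taking delta = epsilon / (B sqrt r) gives delta > epsilon / B and keeps delta^2 \<le> r < 1. *)

section \<open>Diagonal states and measurements\<close>

definition real_diag :: "nat \<Rightarrow> (nat \<Rightarrow> real) \<Rightarrow> complex mat" where
  "real_diag D w = mat_diag D (\<lambda>x. complex_of_real (w x))"

lemma real_diag_index [simp]:
  "i < D \<Longrightarrow> j < D \<Longrightarrow> real_diag D w $$ (i, j) = (if i = j then complex_of_real (w i) else 0)"
  by (auto simp: real_diag_def mat_diag_def)

lemma real_diag_dim [simp]: "dim_row (real_diag D w) = D" "dim_col (real_diag D w) = D"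
  by (auto simp: real_diag_def mat_diag_def)

lemma real_diag_carrier [simp]: "real_diag D w \<in> carrier_mat D D"
  by (auto simp: real_diag_def)

lemma mat_trace_mult_real_diag:
  assumes "A \<in> carrier_mat D D"
  shows "mat_trace (A * real_diag D w) = (\<Sum>x<D. A $$ (x, x) * complex_of_real (w x))"
  using assms by (simp add: mat_trace_def real_diag_def mat_diag_mult_right[OF assms])

lemma real_diag_mult_vec:
  assumes "v \<in> carrier_vec D"
  shows "real_diag D w *\<^sub>v v = vec D (\<lambda>i. complex_of_real (w i) * v $ i)"
  using assms
  by (auto simp: scalar_prod_def if_distrib[of "\<lambda>x. x * _"] cong: if_cong)

text \<open>Evaluate the quadratic form at a standard basis vector.\<close>

lemma pos_semidef_diag_nonneg:
  assumes "pos_semidef D A" and "x < D"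
  shows "0 \<le> Re (A $$ (x, x))"
proof -
  have A: "A \<in> carrier_mat D D" using assms(1) by (simp add: pos_semidef_def)
  have conj: "conjugate (unit_vec D x) = (unit_vec D x :: complex vec)"
    by (rule eq_vecI) (auto simp: unit_vec_def)
  have "(A *\<^sub>v unit_vec D x) \<bullet>c unit_vec D x = A $$ (x, x)"
    using A assms(2) conj by simp
  moreover have "0 \<le> (A *\<^sub>v unit_vec D x) \<bullet>c unit_vec D x"
    using assms(1) by (simp add: pos_semidef_def)
  ultimately show ?thesis by (simp add: less_eq_complex_def)
qed

lemma pos_semidef_real_diag:
  assumes "\<And>x. x < D \<Longrightarrow> 0 \<le> w x"
  shows "pos_semidef D (real_diag D w)"
  unfolding pos_semidef_def
proof (intro conjI ballI)
  fix v :: "complex vec" assume v: "v \<in> carrier_vec D"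
  have "(real_diag D w *\<^sub>v v) \<bullet>c v = (\<Sum>i<D. complex_of_real (w i) * (v $ i * cnj (v $ i)))"
    using v by (simp add: real_diag_mult_vec scalar_prod_def lessThan_atLeast0 mult.assoc)
  also have "\<dots> = complex_of_real (\<Sum>i<D. w i * (cmod (v $ i))\<^sup>2)"
    by (simp add: complex_norm_square[symmetric])
  finally show "0 \<le> (real_diag D w *\<^sub>v v) \<bullet>c v"
    using assms by (auto simp: less_eq_complex_def intro!: sum_nonneg)
qed simp

lemma density_real_diag:
  assumes "\<And>x. x < 2 ^ n \<Longrightarrow> 0 \<le> w x" and "(\<Sum>x<2 ^ n. w x) = 1"
  shows "density n (real_diag (2 ^ n) w)"
proof -
  have "mat_trace (real_diag (2 ^ n) w) = complex_of_real (\<Sum>x<2 ^ n. w x)"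
    by (simp add: mat_trace_def)
  with assms show ?thesis by (simp add: density_def pos_semidef_real_diag)
qed

lemma spectral_norm_real_diag_le:
  assumes "0 < D" and "0 \<le> B" and "\<And>x. x < D \<Longrightarrow> \<bar>w x\<bar> \<le> B"
  shows "spectral_norm (real_diag D w) \<le> B"
  unfolding spectral_norm_def
proof (rule cSup_least)
  \<comment> \<open>\<open>cSup_least\<close> needs a nonempty set of norms; since
    \<open>0 < D\<close>, the first basis vector supplies a member.\<close>
  have "vec_l2norm (unit_vec D 0) = 1"
    using assms(1) by (simp add: vec_l2norm_def)
  thus "{vec_l2norm (real_diag D w *\<^sub>v v) |v.
      v \<in> carrier_vec (dim_col (real_diag D w)) \<and> vec_l2norm v = 1} \<noteq> {}"
    by (auto intro!: exI[of _ "unit_vec D 0"])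
next
  fix a assume "a \<in> {vec_l2norm (real_diag D w *\<^sub>v v) |v.
      v \<in> carrier_vec (dim_col (real_diag D w)) \<and> vec_l2norm v = 1}"
  then obtain v where v: "v \<in> carrier_vec D" and a: "a = vec_l2norm (real_diag D w *\<^sub>v v)"
    and v1: "vec_l2norm v = 1" by auto
  have l2: "vec_l2norm u = sqrt (\<Sum>i<D. (cmod (u $ i))\<^sup>2)" if "u \<in> carrier_vec D" for u
  proof -
    have "u \<bullet>c u = complex_of_real (\<Sum>i<D. (cmod (u $ i))\<^sup>2)"
      using that by (simp add: scalar_prod_def lessThan_atLeast0 complex_norm_square[symmetric])
    thus ?thesis by (simp add: vec_l2norm_def)
  qed
  have "(\<Sum>i<D. (cmod ((real_diag D w *\<^sub>v v) $ i))\<^sup>2) = (\<Sum>i<D. \<bar>w i\<bar>\<^sup>2 * (cmod (v $ i))\<^sup>2)"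
    using v by (intro sum.cong) (simp_all add: real_diag_mult_vec norm_mult power_mult_distrib)
  also have "\<dots> \<le> (\<Sum>i<D. B\<^sup>2 * (cmod (v $ i))\<^sup>2)"
    using assms(3) by (intro sum_mono mult_right_mono power_mono) auto
  also have "\<dots> = B\<^sup>2 * (\<Sum>i<D. (cmod (v $ i))\<^sup>2)"
    by (simp add: sum_distrib_left)
  also have "(\<Sum>i<D. (cmod (v $ i))\<^sup>2) = 1"
    using v1 l2[OF v] by simp
  finally have "(\<Sum>i<D. (cmod ((real_diag D w *\<^sub>v v) $ i))\<^sup>2) \<le> B\<^sup>2" by simp
  hence "vec_l2norm (real_diag D w *\<^sub>v v) \<le> sqrt (B\<^sup>2)"
    unfolding l2[OF mult_mat_vec_carrier[OF real_diag_carrier v]] by (rule real_sqrt_le_mono)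
  thus "a \<le> B" using a assms(2) by simp
qed

lemma mat_adjoint_real_diag: "mat_adjoint (real_diag D w) = real_diag D w"
  by (rule eq_matI) (auto simp: mat_adjoint_def mat_of_rows_def)

section \<open>Tensor powers of diagonal states\<close>

text \<open>An index below \<open>D ^ N\<close> is read as a string of \<open>N\<close> digits in
  base \<open>D\<close>, and the weight is the product of \<open>w\<close> over the digits. The
  leading digit belongs to the first tensor factor, which is the indexing used by
  \<open>kron\<close>.\<close>

fun iid_weight :: "nat \<Rightarrow> (nat \<Rightarrow> real) \<Rightarrow> nat \<Rightarrow> nat \<Rightarrow> real" where
  "iid_weight D w 0 x = 1"
| "iid_weight D w (Suc N) x = w (x div D ^ N) * iid_weight D w N (x mod D ^ N)"

lemma kron_pow_real_diag:
  assumes "0 < D"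
  shows "kron_pow (real_diag D w) N = real_diag (D ^ N) (iid_weight D w N)"
proof (induction N)
  case (Suc N)
  have eq: "i div D ^ N = j div D ^ N \<Longrightarrow> i mod D ^ N = j mod D ^ N \<Longrightarrow> i = j" for i j :: nat
    by (metis div_mult_mod_eq)
  have lt: "i div D ^ N < D" if "i < D * D ^ N" for i :: nat
    using that by (simp add: less_mult_imp_div_less)
  have [simp]: "i mod D ^ N < D ^ N" for i :: nat using assms by simp
  show ?case
    by (rule eq_matI) (auto simp: Suc kron_def lt dest: eq)
qed (rule eq_matI; simp)

text \<open>Quotient and remainder by \<open>K\<close> identify the indices below
  \<open>D * K\<close> with pairs. This factorization serves twice: with \<open>K = D ^ N\<close> to
  split off one copy, and with \<open>K = 2 ^ n\<close> to split off the top qubit.\<close>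

lemma sum_div_mod:
  fixes f g :: "nat \<Rightarrow> 'a :: comm_semiring_0"
  shows "(\<Sum>x<D * K. f (x div K) * g (x mod K)) = (\<Sum>a<D. f a) * (\<Sum>b<K. g b)"
proof (cases "K = 0")
  case False
  have "(\<Sum>x<D * K. f (x div K) * g (x mod K)) = (\<Sum>(a, b)\<in>{..<D} \<times> {..<K}. f a * g b)"
  proof (rule sum.reindex_bij_witness[where i = "\<lambda>(a, b). a * K + b" and j = "\<lambda>x. (x div K, x mod K)"])
    fix y assume "y \<in> {..<D} \<times> {..<K}"
    then obtain a b where y: "y = (a, b)" "a < D" "b < K" by auto
    have "a * K + b < Suc a * K" using y by simp
    also have "\<dots> \<le> D * K" using y by (intro mult_right_mono) auto
    finally show "(case y of (a, b) \<Rightarrow> a * K + b) \<in> {..<D * K}" using y by simp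
  qed (use False in \<open>auto simp: less_mult_imp_div_less\<close>)
  thus ?thesis by (simp add: sum_product sum.cartesian_product)
qed simp

lemma sum_iid_weight: "(\<Sum>x<D ^ N. iid_weight D w N x) = (\<Sum>y<D. w y) ^ N"
  by (induction N) (simp_all add: sum_div_mod)

lemma iid_weight_pos: "(\<And>y. 0 < w y) \<Longrightarrow> 0 < iid_weight D w N x"
  by (induction N arbitrary: x) auto

text \<open>The chi-squared summand is multiplicative over copies. Together with
  \<open>sum_iid_weight\<close>, this makes the quantity for \<open>N\<close> copies the
  \<open>N\<close>-th power of that for one copy.\<close>

lemma iid_weight_chi: "(iid_weight D q N x)\<^sup>2 / iid_weight D r N x = iid_weight D (\<lambda>y. (q y)\<^sup>2 / r y) N x"
  by (induction N arbitrary: x) (simp_all add: power_mult_distrib flip: times_divide_times_eq)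

section \<open>Effects as classical tests on diagonal states\<close>

lemma outcome_prob_real_diag:
  assumes "E S \<in> carrier_mat D D"
  shows "outcome_prob E (real_diag D w) S = (\<Sum>x<D. Re (E S $$ (x, x)) * w x)"
  using assms by (simp add: outcome_prob_def mat_trace_mult_real_diag)

lemma povm_finite_additive:
  fixes \<Omega> :: "'a measure" and m :: nat
  assumes E: "povm D \<Omega> E" and x: "x < D"
    and A: "\<And>k. k < m \<Longrightarrow> A k \<in> sets \<Omega>" and disj: "disjoint_family_on A {..<m}"
  shows "E (\<Union>k<m. A k) $$ (x, x) = (\<Sum>k<m. E (A k) $$ (x, x))"
proof -
  have add: "(\<lambda>k. E (F k) $$ (x, x)) sums (E (\<Union>k. F k) $$ (x, x))"
    if "range F \<subseteq> sets \<Omega>" "disjoint_family F" for F :: "nat \<Rightarrow> 'a set"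
    using E x that unfolding povm_def by blast
  \<comment> \<open>Countable additivity on a constantly empty family gives a convergent series with
    constant terms, so the term is 0. The finite family can then be padded with empty sets.\<close>
  have "(\<lambda>k::nat. E {} $$ (x, x)) sums (E (\<Union>k::nat. {}) $$ (x, x))"
    by (rule add) (auto simp: disjoint_family_on_def)
  hence "(\<lambda>k::nat. E {} $$ (x, x)) \<longlonglongrightarrow> 0"
    using sums_summable summable_LIMSEQ_zero by blast
  hence empty: "E {} $$ (x, x) = 0"
    by (simp add: LIMSEQ_const_iff)
  define F where "F k = (if k < m then A k else {})" for k
  have "(\<lambda>k. E (F k) $$ (x, x)) sums (E (\<Union>k. F k) $$ (x, x))"
    using A disj by (intro add) (auto simp: F_def disjoint_family_on_def)
  moreover have "(\<Union>k. F k) = (\<Union>k<m. A k)"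
    by (auto simp: F_def split: if_splits)
  moreover have "(\<lambda>k. E (F k) $$ (x, x)) sums (\<Sum>k<m. E (F k) $$ (x, x))"
    by (rule sums_finite) (auto simp: F_def empty)
  ultimately have "E (\<Union>k<m. A k) $$ (x, x) = (\<Sum>k<m. E (F k) $$ (x, x))"
    using sums_unique2 by metis
  thus ?thesis by (simp add: F_def)
qed

text \<open>The diagonal entries of the effects of \<open>S\<close> and of its complement add up to
  1, and the latter is nonnegative.\<close>

lemma povm_diag_le_one:
  assumes E: "povm D \<Omega> E" and x: "x < D" and S: "S \<in> sets \<Omega>"
  shows "Re (E S $$ (x, x)) \<le> 1"
proof -
  define A where "A k = (if k = 0 then S else space \<Omega> - S)" for k :: nat
  have "E (\<Union>k<2. A k) $$ (x, x) = (\<Sum>k<2. E (A k) $$ (x, x))"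
    using S by (intro povm_finite_additive[OF E x]) (auto simp: A_def disjoint_family_on_def)
  also have "(\<Union>k<2. A k) = space \<Omega>"
    using sets.sets_into_space[OF S] by (auto simp: A_def lessThan_nat_numeral)
  also have "E (space \<Omega>) $$ (x, x) = 1"
    using E x by (simp add: povm_def)
  finally have "1 = Re (E S $$ (x, x)) + Re (E (space \<Omega> - S) $$ (x, x))"
    by (simp add: A_def numeral_2_eq_2 complex_eq_iff)
  moreover have "0 \<le> Re (E (space \<Omega> - S) $$ (x, x))"
    using E x S by (intro pos_semidef_diag_nonneg[of D]) (auto simp: povm_def)
  ultimately show ?thesis by simp
qed

lemma povm_sum_outcome_prob_le_one:
  fixes m :: nat
  assumes E: "povm D \<Omega> E" and w: "\<And>x. x < D \<Longrightarrow> 0 \<le> w x" "(\<Sum>x<D. w x) = 1"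
    and A: "\<And>k. k < m \<Longrightarrow> A k \<in> sets \<Omega>" and disj: "disjoint_family_on A {..<m}"
  shows "(\<Sum>k<m. outcome_prob E (real_diag D w) (A k)) \<le> 1"
proof -
  have car: "E S \<in> carrier_mat D D" if "S \<in> sets \<Omega>" for S
    using E that by (auto simp: povm_def pos_semidef_def)
  have U: "(\<Union>k<m. A k) \<in> sets \<Omega>" using A by (intro sets.finite_UN) auto
  have "(\<Sum>k<m. outcome_prob E (real_diag D w) (A k))
      = (\<Sum>k<m. \<Sum>x<D. Re (E (A k) $$ (x, x)) * w x)"
    using A car by (intro sum.cong) (auto simp: outcome_prob_real_diag)
  also have "\<dots> = (\<Sum>x<D. Re (\<Sum>k<m. E (A k) $$ (x, x)) * w x)"
    by (subst sum.swap) (simp add: sum_distrib_right)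
  also have "\<dots> = (\<Sum>x<D. Re (E (\<Union>k<m. A k) $$ (x, x)) * w x)"
    by (intro sum.cong refl) (simp add: povm_finite_additive[OF E _ A disj])
  also have "\<dots> \<le> (\<Sum>x<D. 1 * w x)"
    using w by (intro sum_mono mult_right_mono povm_diag_le_one[OF E _ U]) auto
  finally show ?thesis using w by simp
qed

text \<open>With \<open>e\<close> the diagonal of the effect, this is Cauchy-Schwarz for the
  splitting \<open>e * q = sqrt (e * r) * (sqrt e * q / sqrt r)\<close>. In the second factor
  \<open>e\<close> is then bounded by 1, leaving one plus the chi-squared divergence when
  \<open>q\<close> and \<open>r\<close> are probability weights.\<close>

lemma outcome_prob_change_of_measure:
  assumes E: "povm D \<Omega> E" and S: "S \<in> sets \<Omega>" and r: "\<And>x. x < D \<Longrightarrow> 0 < r x"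
  shows "(outcome_prob E (real_diag D q) S)\<^sup>2
    \<le> outcome_prob E (real_diag D r) S * (\<Sum>x<D. (q x)\<^sup>2 / r x)"
proof -
  have car: "E S \<in> carrier_mat D D" and pos: "\<And>x. x < D \<Longrightarrow> 0 \<le> Re (E S $$ (x, x))"
    using E S pos_semidef_diag_nonneg by (auto simp: povm_def pos_semidef_def)
  define e where "e x = Re (E S $$ (x, x))" for x
  have e: "0 \<le> e x" "e x \<le> 1" if "x < D" for x
    using pos povm_diag_le_one[OF E _ S] that by (auto simp: e_def)
  have "(\<Sum>x<D. e x * q x) = (\<Sum>x<D. sqrt (e x * r x) * (sqrt (e x) * q x / sqrt (r x)))"
    using e r by (intro sum.cong refl) (force simp: real_sqrt_mult)
  hence "(\<Sum>x<D. e x * q x)\<^sup>2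
      \<le> (\<Sum>x<D. (sqrt (e x * r x))\<^sup>2) * (\<Sum>x<D. (sqrt (e x) * q x / sqrt (r x))\<^sup>2)"
    by (simp only: Cauchy_Schwarz_ineq_sum)
  also have "(\<Sum>x<D. (sqrt (e x * r x))\<^sup>2) = (\<Sum>x<D. e x * r x)"
    using e r by (intro sum.cong refl real_sqrt_pow2) (simp add: less_imp_le)
  also have "(\<Sum>x<D. (sqrt (e x) * q x / sqrt (r x))\<^sup>2) = (\<Sum>x<D. e x * ((q x)\<^sup>2 / r x))"
    using e r by (intro sum.cong refl) (simp add: power_mult_distrib power_divide less_imp_le)
  also have "(\<Sum>x<D. e x * r x) * \<dots> \<le> (\<Sum>x<D. e x * r x) * (\<Sum>x<D. (q x)\<^sup>2 / r x)"
    using e r by (intro mult_left_mono sum_mono sum_nonneg mult_left_le_one_le)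
      (auto simp: less_imp_le)
  finally show ?thesis
    using car by (simp add: outcome_prob_real_diag e_def)
qed

section \<open>Products of biased bits\<close>

text \<open>Distributivity over bit strings: in the induction the top digit becomes the quotient by
  \<open>2 ^ n\<close>, while the lower digits depend only on the remainder.\<close>

lemma sum_prod_bits:
  fixes f :: "nat \<Rightarrow> bool \<Rightarrow> 'a :: comm_semiring_1"
  shows "(\<Sum>y<2 ^ n. \<Prod>i<n. f i (bit (y :: nat) i)) = (\<Prod>i<n. f i False + f i True)"
proof (induction n)
  case (Suc n)
  let ?g = "\<lambda>y :: nat. \<Prod>i<n. f i (bit y i)"
  have "?g y = ?g (y mod 2 ^ n)" for y
    by (intro prod.cong refl) (simp add: bit_take_bit_iff flip: take_bit_eq_mod)
  hence "(\<Sum>y<2 ^ Suc n. \<Prod>i<Suc n. f i (bit (y :: nat) i))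
      = (\<Sum>y<2 * 2 ^ n. f n (odd (y div 2 ^ n)) * ?g (y mod 2 ^ n))"
    by (simp add: bit_iff_odd[of _ n] mult.commute)
  also have "\<dots> = (\<Sum>a<2. f n (odd (a :: nat))) * (\<Sum>y<2 ^ n. ?g y)"
    by (rule sum_div_mod)
  also have "(\<Sum>a<2. f n (odd (a :: nat))) = f n False + f n True"
    by (simp add: numeral_2_eq_2)
  finally show ?case
    by (simp add: Suc mult.commute)
qed (simp add: lessThan_Suc)

text \<open>The eigenvalue of Pauli Z on qubit \<open>q\<close> at the basis state
  \<open>y\<close>.\<close>

definition bit_sign :: "nat \<Rightarrow> nat \<Rightarrow> real" where
  "bit_sign q y = (if bit y q then - 1 else 1)"

text \<open>The law of \<open>n\<close> independent bits, where \<open>s i\<close> is the expected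
  sign of bit \<open>i\<close>; it is a probability law when each \<open>s i\<close> lies between -1
  and 1.\<close>

definition bias_weight :: "nat \<Rightarrow> (nat \<Rightarrow> real) \<Rightarrow> nat \<Rightarrow> real" where
  "bias_weight n s y = (\<Prod>i<n. (1 + s i * bit_sign i y) / 2)"

lemma sum_bias_weight: "(\<Sum>y<2 ^ n. bias_weight n s y) = 1"
  using sum_prod_bits[of "\<lambda>i b. (1 + s i * (if b then - 1 else 1)) / 2" n]
  by (simp add: bias_weight_def bit_sign_def field_simps)

lemma bias_weight_pos:
  assumes "\<And>i. \<bar>s i\<bar> < 1"
  shows "0 < bias_weight n s y"
  unfolding bias_weight_def bit_sign_def
proof (rule prod_pos)
  fix i show "0 < (1 + s i * (if bit y i then - 1 else 1)) / 2"
    using assms[of i] by auto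
qed

lemma expectation_bit_sign:
  assumes "q < n"
  shows "(\<Sum>y<2 ^ n. bit_sign q y * bias_weight n s y) = s q"
proof -
  \<comment> \<open>The sign is absorbed into the factor of bit \<open>q\<close>, so the summand
    stays a product over bits. That factor sums to
    \<open>(1 + s q) / 2 - (1 - s q) / 2 = s q\<close>, every other one to 1.\<close>
  define f where "f i b = (if i = q then (if b then - 1 else 1) else 1) *
      ((1 + s i * (if b then - 1 else 1)) / 2)" for i b
  have "bit_sign q y * bias_weight n s y = (\<Prod>i<n. f i (bit y i))" for y
    unfolding f_def prod.distrib using assms
    by (simp add: bias_weight_def bit_sign_def)
  hence "(\<Sum>y<2 ^ n. bit_sign q y * bias_weight n s y) = (\<Prod>i<n. f i False + f i True)"
    by (simp add: sum_prod_bits)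
  also have "\<dots> = (\<Prod>i<n. if i = q then s q else 1)"
    by (intro prod.cong) (auto simp: f_def field_simps)
  finally show ?thesis using assms by simp
qed

text \<open>The sum factorizes over bits. A single bit contributes
  \<open>((1 + s)^2 / (1 + t) + (1 - s)^2 / (1 - t)) / 2\<close>, whose numerator over
  \<open>1 - t^2\<close> is \<open>1 + s^2 - 2 * s * t = (1 - t^2) + (s - t)^2\<close>.\<close>

lemma chi_squared_bias_weight:
  assumes t: "\<And>i. \<bar>t i\<bar> < 1"
  shows "(\<Sum>y<2 ^ n. (bias_weight n s y)\<^sup>2 / bias_weight n t y)
    = (\<Prod>i<n. 1 + (s i - t i)\<^sup>2 / (1 - (t i)\<^sup>2))"
proof -
  define f where "f i b = ((1 + s i * (if b then - 1 else 1)) / 2)\<^sup>2 /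
      ((1 + t i * (if b then - 1 else 1)) / 2)" for i b
  have "(bias_weight n s y)\<^sup>2 / bias_weight n t y = (\<Prod>i<n. f i (bit y i))" for y
    by (simp only: bias_weight_def bit_sign_def f_def prod_power_distrib flip: prod_dividef)
  hence "(\<Sum>y<2 ^ n. (bias_weight n s y)\<^sup>2 / bias_weight n t y) = (\<Prod>i<n. f i False + f i True)"
    by (simp add: sum_prod_bits)
  also have "\<dots> = (\<Prod>i<n. 1 + (s i - t i)\<^sup>2 / (1 - (t i)\<^sup>2))"
  proof (intro prod.cong refl)
    fix i
    have "1 + t i \<noteq> 0" "1 - t i \<noteq> 0" using t[of i] by auto
    moreover have "1 - (t i)\<^sup>2 = (1 + t i) * (1 - t i)"
      by (simp add: power2_eq_square algebra_simps)
    ultimately show "f i False + f i True = 1 + (s i - t i)\<^sup>2 / (1 - (t i)\<^sup>2)"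
      by (simp add: f_def divide_simps) (simp add: power2_eq_square algebra_simps)
  qed
  finally show ?thesis .
qed

section \<open>Single-qubit Pauli Z observables\<close>

lemma acts_trivially_on_real_diag:
  assumes "\<And>y. w (unset_bit q y) = w y"
  shows "acts_trivially_on n q (real_diag (2 ^ n) w)"
proof -
  have eq: "i = j" if "bit i q = bit j q" "unset_bit q i = unset_bit q j" for i j :: nat
  proof (rule bit_eqI)
    fix l
    have "bit (unset_bit q i) l = bit (unset_bit q j) l" using that by simp
    thus "bit i l = bit j l" using that(1) by (cases "l = q") (auto simp: bit_unset_bit_iff)
  qed
  show ?thesis
    \<comment> \<open>The witness is the same diagonal operator on the remaining qubits: for indices
      that agree in digit \<open>q\<close>, clearing that digit loses no information, so
      off-diagonal entries stay 0.\<close>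
    unfolding acts_trivially_on_def
    by (rule exI[of _ "\<lambda>a b. if a = b then complex_of_real (w a) else 0"])
      (use eq assms in auto)
qed

text \<open>A sum with one summand, supported on at most the qubit \<open>q\<close>; this is where
  \<open>k\<close> and \<open>d\<close> must be at least 1.\<close>

lemma few_body_sum_pauli_Z:
  assumes "1 \<le> k" and "1 \<le> d"
  shows "few_body_sum n k d (real_diag (2 ^ n) (\<lambda>y. B * bit_sign q y))" (is "few_body_sum n k d ?A")
proof -
  have "acts_trivially_on n l ?A" if "l \<noteq> q" for l
    using that by (intro acts_trivially_on_real_diag) (simp add: bit_sign_def bit_unset_bit_iff)
  hence "qubit_support n ?A \<subseteq> {q}"
    by (auto simp: qubit_support_def)
  hence "card (qubit_support n ?A) \<le> 1"
    using card_mono[of "{q}"] by fastforce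
  hence "few_body n k ?A"
    using assms by (simp add: few_body_def observable_def mat_adjoint_real_diag)
  moreover have "card {a. a < length [?A] \<and> l \<in> qubit_support n ([?A] ! a)} \<le> d" for l
  proof -
    have "card {a. a < length [?A] \<and> l \<in> qubit_support n ([?A] ! a)} \<le> card {0 :: nat}"
      by (rule card_mono) auto
    thus ?thesis using assms by simp
  qed
  moreover have "?A = foldr (+) [?A] (0\<^sub>m (2 ^ n) (2 ^ n))"
    by simp
  ultimately show ?thesis
    unfolding few_body_sum_def by (intro exI[of _ "[?A]"]) auto
qed

lemma admissible_pauli_Z:
  assumes "1 \<le> k" and "1 \<le> d" and "0 < B"
  shows "admissible_observables n M k d B
    (map (\<lambda>i. real_diag (2 ^ n) (\<lambda>y. B * bit_sign (g i) y)) [0..<M])"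
proof -
  have "spectral_norm (real_diag (2 ^ n) (\<lambda>y. B * bit_sign q y)) \<le> B" for q
    using assms by (intro spectral_norm_real_diag_le) (auto simp: bit_sign_def)
  thus ?thesis
    using assms by (auto simp: admissible_observables_def few_body_sum_pauli_Z)
qed

lemma trace_pauli_Z_bias_weight:
  assumes "q < n"
  shows "mat_trace (real_diag (2 ^ n) (\<lambda>y. B * bit_sign q y) * real_diag (2 ^ n) (bias_weight n s))
    = complex_of_real (B * s q)"
proof -
  have "mat_trace (real_diag (2 ^ n) (\<lambda>y. B * bit_sign q y) * real_diag (2 ^ n) (bias_weight n s))
      = complex_of_real (B * (\<Sum>y<2 ^ n. bit_sign q y * bias_weight n s y))"
    by (simp add: mat_trace_mult_real_diag sum_distrib_left mult.assoc)
  thus ?thesis using assms by (simp add: expectation_bit_sign)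
qed

lemma sets_accurate_estimates:
  "accurate_estimates Os \<rho> \<epsilon> \<in> sets (estimate_space (length Os))"
  unfolding accurate_estimates_def by measurable

section \<open>Distinguishing the biased bit\<close>

text \<open>The bias \<open>\<delta>\<close> stays free here:
  \<open>\<epsilon> < B * \<delta>\<close> keeps the answers distinguishable, and
  \<open>\<delta> < 1\<close> keeps all weights positive.\<close>

lemma hypothesis_testing_bound:
  assumes "1 \<le> k" and "1 \<le> d" and "1 \<le> n" and "0 < B"
    and \<delta>: "\<epsilon> < B * \<delta>" "0 < \<delta>" "\<delta> < 1"
    and solves: "solves_task n M k d B \<epsilon> p N alg" and "0 \<le> p"
  shows "real (min M n) * p\<^sup>2 \<le> (1 - p) * (1 + 4 * \<delta>\<^sup>2 / (1 - \<delta>\<^sup>2)) ^ N"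
proof -
  define m where "m = min M n"
  \<comment> \<open>Reduction modulo \<open>n\<close> repeats qubits when \<open>M > n\<close>; the
    first \<open>m\<close> observables always act on the distinct qubits
    \<open>0, ..., m - 1\<close>.\<close>
  define Os where "Os = map (\<lambda>i. real_diag (2 ^ n) (\<lambda>y. B * bit_sign (i mod n) y)) [0..<M]"
  define E where "E = alg Os"
  define D where "D = (2 :: nat) ^ n"
  define t where "t = (\<lambda>i :: nat. - \<delta>)"
  \<comment> \<open>Every index \<open>j\<close> from \<open>m\<close> on yields the reference
    biases, so \<open>j = m\<close> names the reference state and all \<open>m + 1\<close>
    hypotheses are treated uniformly.\<close>
  define s where "s j = (if j < m then t(j := \<delta>) else t)" for j
  define w where "w j = bias_weight n (s j)" for j
  define P where "P j = outcome_prob E (real_diag (D ^ N) (iid_weight D (w j) N))" for j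
  define A where "A j = accurate_estimates Os (real_diag D (w j)) \<epsilon>" for j
  have lenO: "length Os = M" by (simp add: Os_def)
  have adm: "admissible_observables n M k d B Os"
    unfolding Os_def using assms by (intro admissible_pauli_Z)
  have D: "0 < D" by (simp add: D_def)
  have E: "povm (D ^ N) (estimate_space M) E"
    using solves adm by (simp add: solves_task_def E_def D_def)
  have bias: "\<bar>s j i\<bar> < 1" for i j
    using \<delta> by (simp add: s_def t_def)
  have wpos: "0 < w j y" for j y
    unfolding w_def by (rule bias_weight_pos) (rule bias)
  have wsum: "(\<Sum>y<D. w j y) = 1" for j
    unfolding w_def D_def by (rule sum_bias_weight)
  have "density n (real_diag D (w j))" for j
    unfolding D_def using wpos wsum by (intro density_real_diag) (auto simp: less_imp_le D_def)
  hence success: "p \<le> P j (A j)" for j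
    using solves adm D by (auto simp: solves_task_def P_def A_def E_def simp flip: kron_pow_real_diag)
  have meas: "A j \<in> sets (estimate_space M)" for j
    using sets_accurate_estimates[of Os] by (simp add: A_def lenO)
  have A: "\<bar>y i - B * s j i\<bar> \<le> \<epsilon>" if "y \<in> A j" "i < m" for y i j
    using that trace_pauli_Z_bias_weight[of i n B "s j"]
    by (auto simp: A_def accurate_estimates_def lenO m_def Os_def D_def w_def)
  \<comment> \<open>An error of at most \<open>\<epsilon> < B * \<delta>\<close> cannot change the
    sign of the true value, which is \<open>B * \<delta>\<close> or its negative. The signs of the
    first \<open>m\<close> estimates thus reveal \<open>j\<close>; for the reference all are
    nonpositive.\<close>
  have sgn: "y i > 0 \<longleftrightarrow> i = j" if "y \<in> A j" "i < m" for y i j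
    using A[OF that] \<delta> that by (auto simp: s_def t_def split: if_splits)
  have disj: "disjoint_family_on A {..<Suc m}"
    unfolding disjoint_family_on_def
  proof (intro ballI impI equals0I)
    fix i j y assume ij: "i \<in> {..<Suc m}" "j \<in> {..<Suc m}" "i \<noteq> j" and y: "y \<in> A i \<inter> A j"
    \<comment> \<open>At most one of two distinct indices is \<open>m\<close>; the estimate at the
      other one would need both signs.\<close>
    from ij have "i < m \<or> j < m" by auto
    thus False using y sgn ij(3) by blast
  qed
  \<comment> \<open>All \<open>m + 1\<close> answer sets are measured in the reference state; its
    own set, \<open>A m\<close>, takes up at least \<open>p\<close>.\<close>
  have "(\<Sum>j<Suc m. P m (A j)) \<le> 1"
    unfolding P_def using meas wpos wsum
    by (intro povm_sum_outcome_prob_le_one[OF E _ _ _ disj])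
      (auto simp: sum_iid_weight intro: less_imp_le[OF iid_weight_pos])
  hence total: "(\<Sum>j<m. P m (A j)) \<le> 1 - p"
    using success[of m] by simp
  have chi: "(\<Sum>y<D. (w j y)\<^sup>2 / w m y) = 1 + 4 * \<delta>\<^sup>2 / (1 - \<delta>\<^sup>2)" if "j < m" for j
  proof -
    have "(\<Sum>y<D. (w j y)\<^sup>2 / w m y) = (\<Prod>i<n. 1 + (s j i - s m i)\<^sup>2 / (1 - (s m i)\<^sup>2))"
      unfolding w_def D_def by (rule chi_squared_bias_weight) (rule bias)
    \<comment> \<open>Only bit \<open>j\<close> differs between the two states, by
      \<open>2 * \<delta>\<close>; since \<open>j < m\<close> and \<open>m\<close> is at most
      \<open>n\<close>, it occurs in the product.\<close>
    also have "\<dots> = (\<Prod>i<n. if i = j then 1 + (2 * \<delta>)\<^sup>2 / (1 - \<delta>\<^sup>2) else 1)"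
      using that by (intro prod.cong) (auto simp: s_def t_def)
    also have "\<dots> = 1 + 4 * \<delta>\<^sup>2 / (1 - \<delta>\<^sup>2)"
      using that by (simp add: m_def)
    finally show ?thesis .
  qed
  have "p\<^sup>2 \<le> P m (A j) * (1 + 4 * \<delta>\<^sup>2 / (1 - \<delta>\<^sup>2)) ^ N" if "j < m" for j
  proof -
    have "p\<^sup>2 \<le> (P j (A j))\<^sup>2"
      using success \<open>0 \<le> p\<close> by (intro power_mono)
    also have "\<dots> \<le> P m (A j) *
        (\<Sum>x<D ^ N. (iid_weight D (w j) N x)\<^sup>2 / iid_weight D (w m) N x)"
      unfolding P_def using wpos
      by (intro outcome_prob_change_of_measure[OF E meas] iid_weight_pos)
    finally show ?thesis
      using that by (simp add: iid_weight_chi sum_iid_weight chi)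
  qed
  hence "(\<Sum>j<m. p\<^sup>2) \<le> (\<Sum>j<m. P m (A j) * (1 + 4 * \<delta>\<^sup>2 / (1 - \<delta>\<^sup>2)) ^ N)"
    by (intro sum_mono) simp
  also have "\<dots> = (\<Sum>j<m. P m (A j)) * (1 + 4 * \<delta>\<^sup>2 / (1 - \<delta>\<^sup>2)) ^ N"
    by (simp add: sum_distrib_right)
  also have "\<dots> \<le> (1 - p) * (1 + 4 * \<delta>\<^sup>2 / (1 - \<delta>\<^sup>2)) ^ N"
    using \<delta> by (intro mult_right_mono total zero_le_power add_nonneg_nonneg divide_nonneg_nonneg)
      (auto simp: power_le_one)
  finally show ?thesis by (simp add: m_def)
qed

section \<open>Choice of constants and solving for the number of copies\<close>

theorem theorem3:
  fixes k d :: nat and p r :: real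
  assumes "1 \<le> k" and "1 \<le> d"
    and "1 / 2 < p" and "p \<le> 1"
    and "0 < r" and "r < 1"
  shows "\<exists>C>0. \<forall>(n :: nat) (M :: nat) (B :: real) (\<epsilon> :: real) (N :: nat) alg.
           1 \<le> n \<longrightarrow> 1 \<le> M \<longrightarrow> 0 < B \<longrightarrow> 0 < \<epsilon> \<longrightarrow> \<epsilon> \<le> r * B \<longrightarrow>
           solves_task n M k d B \<epsilon> p N alg \<longrightarrow>
           real N \<ge> C * (ln (real (min M n)) * B\<^sup>2 / \<epsilon>\<^sup>2)"
proof -
  \<comment> \<open>Positive because \<open>p > 1 / 2\<close>, and chosen so that
    \<open>c * ln 2 = ln (2 * p)\<close>. For \<open>m\<close> at least 2,
    \<open>ln m - ln 2\<close> is at least \<open>c * (ln m - ln 2)\<close>, and the gain from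
    \<open>2 * p\<close> pays for the lost \<open>c * ln 2\<close>.\<close>
  define c where "c = ln (2 * p) / ln 2"
  have c: "0 < c" "c \<le> 1" using assms by (auto simp: c_def)
  \<comment> \<open>Obtained by solving \<open>c * ln m \<le> N * (4 * \<delta>^2 / (1 - r))\<close>
    for \<open>N\<close> with \<open>\<delta>^2 = \<epsilon>^2 / (B^2 * r)\<close>.\<close>
  define C where "C = c * r * (1 - r) / 4"
  have bound: "real N \<ge> C * (ln (real (min M n)) * B\<^sup>2 / \<epsilon>\<^sup>2)"
    if h: "1 \<le> n" "1 \<le> M" "0 < B" "0 < \<epsilon>" "\<epsilon> \<le> r * B"
      and solves: "solves_task n M k d B \<epsilon> p N alg" for n M N :: nat and B \<epsilon> :: real and alg
  \<comment> \<open>For minimum 1 the logarithm vanishes and the bound is trivial.\<close>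
  proof (cases "min M n = 1")
    case False
    define m where "m = min M n"
    have m: "2 \<le> m" using False h by (auto simp: m_def min_def)
    define \<delta> where "\<delta> = \<epsilon> / (B * sqrt r)"
    define a where "a = 4 * \<delta>\<^sup>2 / (1 - \<delta>\<^sup>2)"
    have \<delta>0: "0 < \<delta>" using h assms by (simp add: \<delta>_def)
    have \<delta>sq: "\<delta>\<^sup>2 = \<epsilon>\<^sup>2 / (B\<^sup>2 * r)"
      using assms by (simp add: \<delta>_def power_divide power_mult_distrib)
    have "\<epsilon>\<^sup>2 \<le> (r * B)\<^sup>2" using h by (intro power_mono) auto
    hence \<delta>r: "\<delta>\<^sup>2 \<le> r"
      using h assms unfolding \<delta>sq
      by (subst pos_divide_le_eq) (auto simp: power2_eq_square mult_ac)
    have "\<delta>\<^sup>2 < 1\<^sup>2" using \<delta>r assms by simp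
    hence \<delta>1: "\<delta> < 1" by (rule power_less_imp_less_base) simp
    have "B * \<delta> * sqrt r = \<epsilon>" using h assms by (simp add: \<delta>_def)
    moreover have "B * \<delta> * sqrt r < B * \<delta> * 1"
      using h assms \<delta>0 by (intro mult_strict_left_mono) auto
    ultimately have \<delta>\<epsilon>: "\<epsilon> < B * \<delta>" by simp
    have a0: "0 \<le> a" using \<delta>r assms by (simp add: a_def)
    have "real m * p\<^sup>2 \<le> (1 - p) * (1 + a) ^ N"
      unfolding m_def a_def
      using assms h \<delta>\<epsilon> \<delta>0 \<delta>1 by (intro hypothesis_testing_bound[OF _ _ _ _ _ _ _ solves]) auto
    \<comment> \<open>Replacing \<open>1 - p\<close> by 1/2 keeps the factor positive even for
      \<open>p = 1\<close>, so logarithms can be taken, and leaves a power of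
      \<open>2 * p > 1\<close> on the left.\<close>
    also have "\<dots> \<le> 1 / 2 * (1 + a) ^ N"
      using assms a0 by (intro mult_right_mono) auto
    finally have "real m / 2 * (2 * p)\<^sup>2 \<le> (1 + a) ^ N"
      by (simp add: power2_eq_square mult_ac)
    hence "ln (real m / 2 * (2 * p)\<^sup>2) \<le> ln ((1 + a) ^ N)"
      using m assms by (subst ln_le_cancel_iff) (auto intro: less_le_trans[rotated])
    hence "ln m - ln 2 + 2 * ln (2 * p) \<le> real N * ln (1 + a)"
      using m assms a0 by (simp add: ln_mult ln_div ln_realpow)
    moreover have "real N * ln (1 + a) \<le> real N * a"
      using a0 by (intro mult_left_mono ln_add_one_self_le_self) auto
    moreover have "c * ln 2 \<le> 2 * ln (2 * p)"
      using assms by (simp add: c_def)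
    moreover have "0 \<le> (1 - c) * (ln m - ln 2)"
      using c m by simp
    ultimately have "c * ln m \<le> real N * a"
      by (simp add: algebra_simps)
    also have "a \<le> 4 * \<delta>\<^sup>2 / (1 - r)"
      unfolding a_def using \<delta>r assms by (intro divide_left_mono) auto
    finally have "c * ln m \<le> real N * (4 * \<delta>\<^sup>2 / (1 - r))"
      by (simp add: mult_left_mono)
    thus ?thesis
      using h assms by (simp add: C_def \<delta>sq m_def field_simps)
  qed simp
  have "0 < C" using c assms by (simp add: C_def)
  with bound show ?thesis by blast
qed

end
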